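(* Let $N_{n,n} = \int_0^1 P_n(2x-1)^2\,\log(x)\,dx$ for integers $n\geq 0$, where $P_n$ is the $n$-th Legendre polynomial. Then $$N_{0,0} = -1, \qquad 3N_{1,1} = -\frac{4}{3},$$ and for every integer $n>1$, $$(2n+1)N_{n,n} = (2n-1)N_{n-1,n-1} - \frac{2}{(2n-1)\,2n\,(2n+1)} = -1 - 2\sum_{j=1}^{n} \frac{1}{(2j-1)\,2j\,(2j+1)}.$$
   Context: The Legendre polynomials $P_0,P_1,P_2,\ldots$ are defined by $P_0(x)=1$, $P_1(x)=x$, and for $n\geq 1$ by the three-term recurrence $(n+1)P_{n+1}(x) = (2n+1)\,x\,P_n(x) - n\,P_{n-1}(x)$. For integers $n,m\geq 0$ define $N_{n,m} := \int_0^1 P_n(2x-1)\,P_m(2x-1)\,\log(x)\,dx$, where $\log$ is the natural logarithm. *)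

theory Defs
  imports "HOL-Analysis.Analysis" "HOL-Computational_Algebra.Polynomial"
begin

fun legendre_poly :: "nat \<Rightarrow> real poly" where
  "legendre_poly 0 = 1"
| "legendre_poly (Suc 0) = [:0, 1:]"
| "legendre_poly (Suc (Suc n)) =
     smult (1 / real (n + 2))
       (smult (real (2 * n + 3)) ([:0, 1:] * legendre_poly (Suc n))
        - smult (real (n + 1)) (legendre_poly n))"

text \<open>The defining equation above is the usual three-term recurrence, shifted by one
  and solved for the leading term:\<close>

lemma legendre_poly_recurrence:
  assumes "n \<ge> 1"
  shows "real (n + 1) * poly (legendre_poly (n + 1)) x =
    real (2 * n + 1) * x * poly (legendre_poly n) x - real n * poly (legendre_poly (n - 1)) x"
proof -
  obtain k where "n = Suc k"
    using assms by (cases n) auto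
  then show ?thesis
    by (simp add: field_simps)
qed

text \<open>At the left endpoint, where the logarithm is singular, \<^term>\<open>ln (0::real)\<close> has the value 0;
  this does not affect the integral.\<close>

definition legendre_log_integral :: "nat \<Rightarrow> nat \<Rightarrow> real" where
  "legendre_log_integral n m =
     integral {0..1}
       (\<lambda>x. poly (legendre_poly n) (2 * x - 1) * poly (legendre_poly m) (2 * x - 1) * ln x)"

end

(* Write A = P_(n+1), B = P_n and let I and L be integration over [0,1] of p(2x-1), without and with
   the weight ln x.  The polynomial F = t (A^2 + B^2) - 2 A B has derivative
   (2n+3) A^2 - (2n+1) B^2 and vanishes at -1, so F = (1 + t) p, and integration by parts against
   ln x gives (2n+3) L(A^2) - (2n+1) L(B^2) = L(F') = - I(p).  Because
   (1 + t) (A' - B') = (n+1) (A + B), the quotient is p = A^2 + B^2 - (A + B) (A' - B') / (n+1),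
   and I(p) follows from the norms of A and B and the orthogonality of A to B'. *)

theory Submission
  imports Defs "HOL-Real_Asymp.Real_Asymp"
begin

section \<open>Integration over [0,1] with and without the logarithmic weight\<close>

definition unit_int :: "real poly \<Rightarrow> real" where
  "unit_int p = integral {0..1} (\<lambda>x. poly p (2 * x - 1))"

definition log_int :: "real poly \<Rightarrow> real" where
  "log_int p = integral {0..1} (\<lambda>x. poly p (2 * x - 1) * ln x)"

lemma unit_int_integrable: "(\<lambda>x. poly p (2 * x - 1)) integrable_on {0..1::real}" for p :: "real poly"
  by (intro integrable_continuous_real continuous_intros)

lemma unit_int_add: "unit_int (p + q) = unit_int p + unit_int q"
  unfolding unit_int_def poly_add by (rule integral_add) (rule unit_int_integrable)+

lemma unit_int_smult: "unit_int (smult c p) = c * unit_int p"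
  by (simp add: unit_int_def)

lemma unit_int_diff: "unit_int (p - q) = unit_int p - unit_int q"
  unfolding unit_int_def poly_diff by (rule integral_diff) (rule unit_int_integrable)+

lemma unit_int_pderiv: "unit_int (pderiv p) = (poly p 1 - poly p (-1)) / 2"
proof -
  have "((\<lambda>x. poly (pderiv p) (2 * x - 1)) has_integral
      poly p (2 * 1 - 1) / 2 - poly p (2 * 0 - 1) / 2) {0..1}"
  proof (rule fundamental_theorem_of_calculus)
    fix x :: real
    have "((\<lambda>x. poly p (2 * x - 1) / 2) has_real_derivative poly (pderiv p) (2 * x - 1)) (at x within {0..1})"
      by (auto intro!: derivative_eq_intros DERIV_chain2[OF poly_DERIV])
    then show "((\<lambda>x. poly p (2 * x - 1) / 2) has_vector_derivative poly (pderiv p) (2 * x - 1))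
        (at x within {0..1})"
      by (simp add: has_real_derivative_iff_has_vector_derivative)
  qed simp
  then show ?thesis
    by (simp add: unit_int_def integral_unique diff_divide_distrib)
qed

section \<open>Integration by parts against the logarithm\<close>

lemma continuous_on_mult_ln: "continuous_on {0..} (\<lambda>x::real. x * ln x)"
  unfolding continuous_on_eq_continuous_within
proof
  fix x :: real assume x: "x \<in> {0..}"
  show "continuous (at x within {0..}) (\<lambda>x. x * ln x)"
  proof (cases "x = 0")
    case True
    \<comment> \<open>The factor x makes the value at 0 equal to 0, so this one-sided limit is all
      that continuity there requires.\<close>
    have "((\<lambda>x::real. x * ln x) \<longlongrightarrow> 0) (at_right 0)"
      by real_asymp
    then show ?thesis
      by (simp add: True continuous_within at_within_Ici_at_right)
  next
    case False
    then show ?thesis using x by (intro continuous_intros) auto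
  qed
qed

text \<open>Put t = 2x - 1, so that 1 + t = 2x. The polynomial factor then has the antiderivative x
  p(2x - 1), whose zero at x = 0 absorbs the singularity of ln; at x = 1 the boundary term vanishes
  with ln 1.\<close>

lemma has_integral_pderiv_ln:
  "((\<lambda>x. poly (pderiv ([:1, 1:] * p)) (2 * x - 1) * ln x) has_integral - unit_int p) {0..1}"
proof -
  let ?H = "\<lambda>x. (x * ln x) * poly p (2 * x - 1)"
  have "((\<lambda>x. poly (pderiv ([:1, 1:] * p)) (2 * x - 1) * ln x + poly p (2 * x - 1))
      has_integral ?H 1 - ?H 0) {0..1}"
  \<comment> \<open>At x = 0 only continuity of \<open>?H\<close> is available; the derivative is
    taken where x > 0.\<close>
  proof (rule fundamental_theorem_of_calculus_interior)
    show "continuous_on {0..1} ?H"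
      by (intro continuous_intros continuous_on_subset[OF continuous_on_mult_ln]) auto
    fix x :: real assume "x \<in> {0<..<1}"
    then have "x > 0" by simp
    then have "(?H has_real_derivative
        poly (pderiv ([:1, 1:] * p)) (2 * x - 1) * ln x + poly p (2 * x - 1)) (at x)"
      by (auto intro!: derivative_eq_intros DERIV_chain2[OF poly_DERIV]
          simp: pderiv_add pderiv_pCons field_simps)
    then show "(?H has_vector_derivative
        poly (pderiv ([:1, 1:] * p)) (2 * x - 1) * ln x + poly p (2 * x - 1)) (at x)"
      by (simp add: has_real_derivative_iff_has_vector_derivative)
  qed simp
  from has_integral_diff[OF this integrable_integral[OF unit_int_integrable[of p]]]
  show ?thesis by (simp add: unit_int_def)
qed

lemma log_int_pderiv: "log_int (pderiv ([:1, 1:] * p)) = - unit_int p"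
  unfolding log_int_def by (rule integral_unique) (rule has_integral_pderiv_ln)

text \<open>Termwise integration; it serves to bring an arbitrary polynomial into the form
  \<open>pderiv ([:1, 1:] * p)\<close>.\<close>

lemma pderiv_surj:
  fixes q :: "real poly"
  obtains r where "pderiv r = q"
proof
  show "pderiv (\<Sum>i\<le>degree q. monom (coeff q i / real (Suc i)) (Suc i)) = q"
    by (simp add: higher_pderiv_sum[of 1, simplified] pderiv_monom poly_as_sum_of_monoms del: of_nat_Suc)
qed

text \<open>An antiderivative of q can be shifted by a constant so that it vanishes at -1. It is
  then divisible by 1 + t, and the integration by parts above applies.\<close>

lemma log_int_integrable:
  "(\<lambda>x. poly q (2 * x - 1) * ln x) integrable_on {0..1::real}"
proof -
  obtain r where r: "pderiv r = q" by (rule pderiv_surj)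
  have "poly (r - [:poly r (-1):]) (-1) = 0" by simp
  then have "[:1, 1:] dvd r - [:poly r (-1):]"
    unfolding poly_eq_0_iff_dvd by simp
  then obtain p where p: "r - [:poly r (-1):] = [:1, 1:] * p" ..
  have "pderiv ([:1, 1:] * p) = q"
    unfolding p[symmetric] by (simp add: r pderiv_diff pderiv_pCons)
  with has_integral_pderiv_ln[of p] show ?thesis by auto
qed

lemma log_int_diff: "log_int (p - q) = log_int p - log_int q"
  unfolding log_int_def poly_diff left_diff_distrib
  by (rule integral_diff) (rule log_int_integrable)+

lemma log_int_smult: "log_int (smult c p) = c * log_int p"
  by (simp add: log_int_def mult.assoc)

lemma legendre_log_integral_eq_log_int:
  "legendre_log_integral n m = log_int (legendre_poly n * legendre_poly m)"
  by (simp add: legendre_log_integral_def log_int_def)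

section \<open>Legendre polynomials: endpoint values, derivative relations, orthogonality,
  norms\<close>

lemma legendre_poly_at_1: "poly (legendre_poly n) 1 = 1"
  by (induction n rule: legendre_poly.induct) (auto simp: field_simps)

lemma legendre_poly_at_minus_1: "poly (legendre_poly n) (-1) = (-1) ^ n"
  by (induction n rule: legendre_poly.induct) (auto simp: field_simps)

lemma legendre_poly_Suc_Suc:
  "real (n + 2) * poly (legendre_poly (Suc (Suc n))) x =
    real (2 * n + 3) * x * poly (legendre_poly (Suc n)) x - real (n + 1) * poly (legendre_poly n) x"
  by (simp del: of_nat_add of_nat_mult add: field_simps)

lemma pderiv_legendre_poly_Suc_Suc:
  "real (n + 2) * poly (pderiv (legendre_poly (Suc (Suc n)))) x =
    real (2 * n + 3) * (poly (legendre_poly (Suc n)) x + x * poly (pderiv (legendre_poly (Suc n))) x)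
      - real (n + 1) * poly (pderiv (legendre_poly n)) x"
  by (simp del: of_nat_add of_nat_mult
      add: pderiv_smult pderiv_diff pderiv_mult pderiv_pCons field_simps)

text \<open>The two relations go through one induction together, because the step for the first
  needs both hypotheses.\<close>

lemma legendre_poly_derivative_relations:
  shows "x * poly (pderiv (legendre_poly (Suc n))) x - poly (pderiv (legendre_poly n)) x =
      real (Suc n) * poly (legendre_poly (Suc n)) x"
    and "poly (pderiv (legendre_poly (Suc n))) x - x * poly (pderiv (legendre_poly n)) x =
      real (Suc n) * poly (legendre_poly n) x"
proof (induction n)
  case 0
  { case 1 show ?case by (simp add: pderiv_pCons) }
  { case 2 show ?case by (simp add: pderiv_pCons) }
next
  case (Suc n)
  let ?a = "poly (legendre_poly n) x" and ?a' = "poly (pderiv (legendre_poly n)) x"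
  let ?b = "poly (legendre_poly (Suc n)) x" and ?b' = "poly (pderiv (legendre_poly (Suc n))) x"
  let ?c = "poly (legendre_poly (Suc (Suc n))) x"
    and ?c' = "poly (pderiv (legendre_poly (Suc (Suc n)))) x"
  define k where "k = real n"
  have ih: "x * ?b' - ?a' = (k + 1) * ?b" "?b' - x * ?a' = (k + 1) * ?a"
    using Suc by (simp_all add: k_def algebra_simps del: legendre_poly.simps)
  have c: "(k + 2) * ?c = (2 * k + 3) * x * ?b - (k + 1) * ?a"
    using legendre_poly_Suc_Suc[of n x] by (simp add: k_def add.commute del: legendre_poly.simps)
  have c': "(k + 2) * ?c' = (2 * k + 3) * (?b + x * ?b') - (k + 1) * ?a'"
    using pderiv_legendre_poly_Suc_Suc[of n x] by (simp add: k_def add.commute del: legendre_poly.simps)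
  \<comment> \<open>Eliminating \<open>?a'\<close> from \<open>c'\<close> leaves \<open>?b\<close>
    with coefficient (2k + 3) + (k + 1)^2 = (k + 2)^2.\<close>
  have "(k + 2) * (?c' - x * ?b') = (k + 2) * ((k + 2) * ?b)"
    using c' ih(1) by algebra
  moreover have "k + 2 \<noteq> 0" by (simp add: k_def)
  ultimately have r2: "?c' - x * ?b' = (k + 2) * ?b" by simp
  \<comment> \<open>The hypotheses give (x^2 - 1) b' = (k + 1) (x b - a); inserting this and
    \<open>r2\<close> yields the recurrence for c.\<close>
  have r1: "x * ?c' - ?b' = (k + 2) * ?c"
    using r2 c ih by algebra
  { case 1 show ?case using r1 by (simp add: k_def add.commute del: legendre_poly.simps) }
  { case 2 show ?case using r2 by (simp add: k_def add.commute del: legendre_poly.simps) }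
qed

text \<open>Legendre's equation in Sturm-Liouville form. Eliminating P_(n-1)' from the two relations
  gives (1 - x^2) P_n' = n (P_(n-1) - x P_n); differentiating and using the first relation
  finishes.\<close>

lemma legendre_poly_ode:
  "pderiv ([:1, 0, -1:] * pderiv (legendre_poly n)) = smult (- real n * (real n + 1)) (legendre_poly n)"
proof (cases n)
  case 0
  then show ?thesis by (simp add: pderiv_1)
next
  case (Suc m)
  let ?A = "legendre_poly n" and ?B = "legendre_poly m"
  have rel: "x * poly (pderiv ?A) x - poly (pderiv ?B) x = real n * poly ?A x"
    "poly (pderiv ?A) x - x * poly (pderiv ?B) x = real n * poly ?B x" for x
    using legendre_poly_derivative_relations[where x = x and n = m] by (simp_all add: Suc del: legendre_poly.simps)
  have "[:1, 0, -1:] * pderiv ?A = smult (real n) (?B - [:0, 1:] * ?A)"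
  proof (rule poly_ext)
    fix x
    have "(1 - x * x) * poly (pderiv ?A) x = real n * (poly ?B x - x * poly ?A x)"
      using rel[of x] by algebra
    then show "poly ([:1, 0, -1:] * pderiv ?A) x = poly (smult (real n) (?B - [:0, 1:] * ?A)) x"
      by (simp add: algebra_simps)
  qed
  then have eq: "pderiv ([:1, 0, -1:] * pderiv ?A) = pderiv (smult (real n) (?B - [:0, 1:] * ?A))"
    by simp
  show ?thesis
  proof (rule poly_ext)
    fix x
    have "real n * (poly (pderiv ?B) x - (poly ?A x + x * poly (pderiv ?A) x)) =
      - real n * (real n + 1) * poly ?A x"
      using rel(1)[of x] by algebra
    then show "poly (pderiv ([:1, 0, -1:] * pderiv ?A)) x =
        poly (smult (- real n * (real n + 1)) ?A) x"
      unfolding eq by (simp add: pderiv_smult pderiv_diff pderiv_mult pderiv_pCons algebra_simps)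
  qed
qed

text \<open>Eigenfunctions for distinct eigenvalues: the weight 1 - t^2 vanishes at both endpoints,
  so the boundary terms disappear.\<close>

lemma legendre_poly_orthogonal:
  assumes "m < n"
  shows "unit_int (legendre_poly n * legendre_poly m) = 0"
proof -
  let ?A = "legendre_poly n" and ?B = "legendre_poly m" and ?w = "[:1, 0, -1:] :: real poly"
  let ?c = "real m * (real m + 1) - real n * (real n + 1)"
  \<comment> \<open>Lagrange's identity: the two terms w A' B' cancel.\<close>
  have "pderiv ((?w * pderiv ?A) * ?B - (?w * pderiv ?B) * ?A) = smult ?c (?A * ?B)"
    unfolding pderiv_diff pderiv_mult[of "?w * _"] legendre_poly_ode
    by (rule poly_ext) (simp add: algebra_simps)
  then have "?c * unit_int (?A * ?B) =
      unit_int (pderiv ((?w * pderiv ?A) * ?B - (?w * pderiv ?B) * ?A))"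
    by (simp only: unit_int_smult)
  also have "\<dots> = 0"
    unfolding unit_int_pderiv by simp
  finally have "?c * unit_int (?A * ?B) = 0" .
  moreover have "real m * (real m + 1) < real n * (real n + 1)"
    using assms by (intro mult_strict_mono) auto
  ultimately show ?thesis by simp
qed

text \<open>P_m' is a combination of Legendre polynomials of index below m, obtained by descending
  in steps of two.\<close>

lemma legendre_poly_orthogonal_pderiv:
  assumes "m < n"
  shows "unit_int (legendre_poly n * pderiv (legendre_poly m)) = 0"
  using assms
proof (induction m rule: legendre_poly.induct)
  case 1
  show ?case by (simp add: pderiv_1 unit_int_def)
next
  case 2
  then show ?case using legendre_poly_orthogonal[of 0 n] by (simp add: pderiv_pCons)
next
  case (3 m)
  \<comment> \<open>Adding the two derivative relations for neighbouring indices cancels x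
    P_(m+1)'.\<close>
  have "pderiv (legendre_poly (Suc (Suc m))) =
      smult (real (2 * m + 3)) (legendre_poly (Suc m)) + pderiv (legendre_poly m)"
  proof (rule poly_ext)
    fix x
    show "poly (pderiv (legendre_poly (Suc (Suc m)))) x =
        poly (smult (real (2 * m + 3)) (legendre_poly (Suc m)) + pderiv (legendre_poly m)) x"
      using legendre_poly_derivative_relations(2)[where x = x and n = "Suc m"]
        legendre_poly_derivative_relations(1)[where x = x and n = m]
      by (simp add: algebra_simps del: legendre_poly.simps)
  qed
  then have "legendre_poly n * pderiv (legendre_poly (Suc (Suc m))) =
      smult (real (2 * m + 3)) (legendre_poly n * legendre_poly (Suc m)) +
      legendre_poly n * pderiv (legendre_poly m)"
    by (simp add: distrib_left del: legendre_poly.simps)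
  then show ?case
    using 3 legendre_poly_orthogonal[of "Suc m" n]
    by (simp add: unit_int_add unit_int_smult del: legendre_poly.simps)
qed

text \<open>The derivative regroups as a^2 + b^2 + 2a (x a' - b') - 2b (a' - x b'), where both
  brackets are known. Integrated without weight it gives the norms, with weight ln x the
  recurrence.\<close>

lemma pderiv_legendre_poly_squares:
  defines "A \<equiv> \<lambda>n. legendre_poly (Suc n)" and "B \<equiv> legendre_poly"
  shows "pderiv ([:0, 1:] * (A n * A n + B n * B n) - smult 2 (A n * B n)) =
    smult (2 * real n + 3) (A n * A n) - smult (2 * real n + 1) (B n * B n)"
proof (rule poly_ext)
  fix x
  let ?a = "poly (A n) x" and ?a' = "poly (pderiv (A n)) x"
  let ?b = "poly (B n) x" and ?b' = "poly (pderiv (B n)) x"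
  have "x * ?a' - ?b' = (real n + 1) * ?a" "?a' - x * ?b' = (real n + 1) * ?b"
    using legendre_poly_derivative_relations[where x = x and n = n]
    by (simp_all add: A_def B_def algebra_simps del: legendre_poly.simps)
  then have "?a * ?a + ?b * ?b + x * (2 * ?a * ?a' + 2 * ?b * ?b') - 2 * (?a * ?b' + ?b * ?a') =
      (2 * real n + 3) * (?a * ?a) - (2 * real n + 1) * (?b * ?b)"
    by algebra
  then show "poly (pderiv ([:0, 1:] * (A n * A n + B n * B n) - smult 2 (A n * B n))) x =
      poly (smult (2 * real n + 3) (A n * A n) - smult (2 * real n + 1) (B n * B n)) x"
    by (simp add: pderiv_smult pderiv_diff pderiv_mult pderiv_add pderiv_pCons algebra_simps)
qed

lemma unit_int_legendre_poly_square:
  "unit_int (legendre_poly n * legendre_poly n) = 1 / (2 * real n + 1)"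
proof (induction n)
  case 0
  show ?case by (simp add: unit_int_def)
next
  case (Suc n)
  \<comment> \<open>The polynomial differentiated in \<open>pderiv_legendre_poly_squares\<close>
    vanishes at 1 and at -1, so (2n + 1) times the squared norm does not depend on n.\<close>
  have "(2 * real n + 3) * unit_int (legendre_poly (Suc n) * legendre_poly (Suc n)) -
      (2 * real n + 1) * unit_int (legendre_poly n * legendre_poly n) = 0"
    unfolding unit_int_smult[symmetric] unit_int_diff[symmetric]
      pderiv_legendre_poly_squares[symmetric] unit_int_pderiv
    by (simp add: legendre_poly_at_1 legendre_poly_at_minus_1 power_mult_distrib[symmetric]
        del: legendre_poly.simps)
  then show ?case using Suc by (simp add: field_simps del: legendre_poly.simps)
qed

section \<open>The recurrence for the diagonal logarithmic integrals and its closed form\<close>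

lemma legendre_log_integral_Suc:
  "(2 * real n + 3) * legendre_log_integral (Suc n) (Suc n) =
    (2 * real n + 1) * legendre_log_integral n n
      - 2 / ((2 * real n + 1) * (2 * real n + 2) * (2 * real n + 3))"
proof -
  let ?A = "legendre_poly (Suc n)" and ?B = "legendre_poly n"
  let ?r = "(?A + ?B) * (pderiv ?A - pderiv ?B)"
  let ?p = "?A * ?A + ?B * ?B - smult (1 / (real n + 1)) ?r"
  have "[:0, 1:] * (?A * ?A + ?B * ?B) - smult 2 (?A * ?B) = [:1, 1:] * ?p"
  proof (rule poly_ext)
    fix x
    let ?a = "poly ?A x" and ?a' = "poly (pderiv ?A) x"
    let ?b = "poly ?B x" and ?b' = "poly (pderiv ?B) x"
    \<comment> \<open>Sum of the two derivative relations.\<close>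
    have "(1 + x) * (?a' - ?b') = (real n + 1) * (?a + ?b)"
      using legendre_poly_derivative_relations[where x = x and n = n]
      by (simp add: algebra_simps del: legendre_poly.simps)
    then have "(1 + x) * ((?a + ?b) * (?a' - ?b') / (real n + 1)) = (?a + ?b) * (?a + ?b)"
      by (simp add: mult.left_commute[of "1 + x"] del: legendre_poly.simps)
    \<comment> \<open>The left side is (1 + x) (a^2 + b^2) - (a + b)^2.\<close>
    then have "x * (?a * ?a + ?b * ?b) - 2 * (?a * ?b) =
        (1 + x) * (?a * ?a + ?b * ?b - (?a + ?b) * (?a' - ?b') / (real n + 1))"
      by algebra
    then show "poly ([:0, 1:] * (?A * ?A + ?B * ?B) - smult 2 (?A * ?B)) x = poly ([:1, 1:] * ?p) x"
      by (simp del: legendre_poly.simps add: distrib_right)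
  qed
  then have 1: "log_int (smult (2 * real n + 3) (?A * ?A) - smult (2 * real n + 1) (?B * ?B)) = - unit_int ?p"
    by (metis pderiv_legendre_poly_squares log_int_pderiv)
  \<comment> \<open>Chosen so that \<open>?r\<close> is an exact derivative up to a multiple of A
    B', which integrates to zero by orthogonality.\<close>
  let ?g = "smult (1 / 2) (?A * ?A - ?B * ?B) + ?A * ?B"
  have "?r = pderiv ?g - smult 2 (?A * pderiv ?B)"
    by (rule poly_ext)
      (simp add: pderiv_smult pderiv_diff pderiv_mult pderiv_add algebra_simps del: legendre_poly.simps)
  then have "unit_int ?r = unit_int (pderiv ?g) - 2 * unit_int (?A * pderiv ?B)"
    by (simp only: unit_int_diff unit_int_smult)
  also have "unit_int (?A * pderiv ?B) = 0"
    by (rule legendre_poly_orthogonal_pderiv) simp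
  \<comment> \<open>The squares cancel at both endpoints, and A B is 1 at 1 and -1 at -1.\<close>
  also have "unit_int (pderiv ?g) = 1"
    unfolding unit_int_pderiv
    by (simp add: legendre_poly_at_1 legendre_poly_at_minus_1 power_mult_distrib[symmetric]
        del: legendre_poly.simps)
  finally have "unit_int ?p = 1 / (2 * real n + 3) + 1 / (2 * real n + 1) - 1 / (real n + 1)"
    using unit_int_legendre_poly_square[of n] unit_int_legendre_poly_square[of "Suc n"]
    by (simp add: unit_int_add unit_int_diff unit_int_smult add.commute del: legendre_poly.simps)
  also have "\<dots> = 2 / ((2 * real n + 1) * (2 * real n + 2) * (2 * real n + 3))"
    by (simp add: divide_simps) (simp add: algebra_simps)
  finally show ?thesis
    using 1 by (simp add: legendre_log_integral_eq_log_int log_int_diff log_int_smult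
        del: legendre_poly.simps)
qed

text \<open>Integration by parts with p = 1, since 1 is the derivative of 1 + t.\<close>

lemma legendre_log_integral_0: "legendre_log_integral 0 0 = -1"
  using log_int_pderiv[of 1]
  by (simp add: legendre_log_integral_eq_log_int pderiv_pCons unit_int_def one_pCons[symmetric])

text \<open>The recurrence telescopes: its correction from n to n + 1 is the summand at j = n +
  1.\<close>

lemma legendre_log_integral_sum:
  "(2 * real n + 1) * legendre_log_integral n n =
    - 1 - 2 * (\<Sum>j = 1..n. 1 / ((2 * real j - 1) * (2 * real j) * (2 * real j + 1)))"
proof (induction n)
  case 0
  show ?case by (simp add: legendre_log_integral_0)
next
  case (Suc n)
  then show ?case using legendre_log_integral_Suc[of n]
    by (simp add: algebra_simps)
qed


theorem theorem2:
  "legendre_log_integral 0 0 = -1 \<and>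
   3 * legendre_log_integral 1 1 = - (4 / 3) \<and>
   (\<forall>n::nat. n > 1 \<longrightarrow>
      (2 * real n + 1) * legendre_log_integral n n =
        (2 * real n - 1) * legendre_log_integral (n - 1) (n - 1)
          - 2 / ((2 * real n - 1) * (2 * real n) * (2 * real n + 1)) \<and>
      (2 * real n - 1) * legendre_log_integral (n - 1) (n - 1)
          - 2 / ((2 * real n - 1) * (2 * real n) * (2 * real n + 1)) =
        - 1 - 2 * (\<Sum>j = 1..n. 1 / ((2 * real j - 1) * (2 * real j) * (2 * real j + 1))))"
proof (intro conjI allI impI)
  show "legendre_log_integral 0 0 = -1"
    by (rule legendre_log_integral_0)
  show "3 * legendre_log_integral 1 1 = - (4 / 3)"
    \<comment> \<open>The single summand is 1/6, giving -1 - 1/3.\<close>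
    using legendre_log_integral_sum[of 1] by simp
  fix n :: nat
  assume "n > 1"
  then obtain m where m: "n = Suc m" by (cases n) auto
  show rec: "(2 * real n + 1) * legendre_log_integral n n =
        (2 * real n - 1) * legendre_log_integral (n - 1) (n - 1)
          - 2 / ((2 * real n - 1) * (2 * real n) * (2 * real n + 1))"
    using legendre_log_integral_Suc[of m] by (simp add: m add.commute)
  show "(2 * real n - 1) * legendre_log_integral (n - 1) (n - 1)
          - 2 / ((2 * real n - 1) * (2 * real n) * (2 * real n + 1)) =
        - 1 - 2 * (\<Sum>j = 1..n. 1 / ((2 * real j - 1) * (2 * real j) * (2 * real j + 1)))"
    using legendre_log_integral_sum[of n] unfolding rec .
qed

end
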